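(* Let $1 \le M_1 < M_2 < \cdots < M_k$ be positive integers. Suppose there is a positive integer $N \in \Sigma_{3,\bar 2}\cap\mathbb{Z}$ such that all the integers $N M_i$ satisfy $$N M_i \in \Sigma_{3,\bar 2}\cap\mathbb{Z}, \qquad 1\le i\le k.$$ Then $$\dim_H(\mathcal{C}(M_1,M_2,\ldots,M_k)) \ge \frac{\log_3 2}{\lceil \log_3(N M_k)\rceil}.$$
   Context: Every $3$-adic integer has a unique expansion $\lambda=\sum_{j=0}^\infty d_j 3^j$ with $d_j\in\{0,1,2\}$; it "omits the digit 2" if every $d_j\in\{0,1\}$. $\Sigma_{3,\bar 2}\subset\mathbb{Z}_3$ (the $3$-adic Cantor set) is the set of $3$-adic integers whose expansion omits the digit $2$; so a positive integer lies in $\Sigma_{3,\bar 2}\cap \mathbb{Z}$ exactly when its base 3 expansion has only digits $0$ and $1$. For positive integers $M_1<\cdots<M_k$, $$\mathcal{C}(M_1,\ldots,M_k) := \{\lambda\in\mathbb{Z}_3 : M_i\lambda \in \Sigma_{3,\bar 2} \text{ for } 1\le i\le k\}.$$ $\dim_H$ denotes Hausdorff dimension with respect to the $3$-adic metric on $\mathbb{Z}_3$, normalized so that each residue class modulo $3^j$ has diameter $3^{-j}$. *)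

theory Defs
  imports "HOL-Analysis.Analysis"
begin

section \<open>The ring of 3-adic integers\<close>

text \<open>
  A 3-adic integer is a compatible system of residues modulo the powers of 3 (inverse limit);
  \<open>res3 x n\<close> is the representative in \<open>{0..<3^n}\<close> of the residue of \<open>x\<close> modulo \<open>3^n\<close>.
\<close>

typedef zadic3 = "{x :: nat \<Rightarrow> int. \<forall>n. x n \<in> {0..<3 ^ n} \<and> x (Suc n) mod 3 ^ n = x n}"
  morphisms res3 Abs_zadic3
  by (rule exI[of _ "\<lambda>_. 0"]) simp

setup_lifting type_definition_zadic3

lemma mod_3_power_Suc_cancel: "(a :: int) mod 3 ^ Suc n mod 3 ^ n = a mod 3 ^ n"
  by (rule mod_mod_cancel) simp

lemma res3_mod_self [simp]: "res3 x n mod 3 ^ n = res3 x n"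
  using res3[of x] by simp

lemma res3_Suc_mod: "res3 x (Suc n) mod 3 ^ n = res3 x n"
  using res3[of x] by simp

lemma res3_nonneg: "0 \<le> res3 x n" and res3_less: "res3 x n < 3 ^ n"
  using res3[of x] by simp_all

lemma res3_0 [simp]: "res3 x 0 = 0"
  using res3_nonneg[of x 0] res3_less[of x 0] by simp

lemma zadic3_eqI: "(\<And>n. res3 x n = res3 y n) \<Longrightarrow> x = y"
  by (metis ext res3_inject)

lemma res3_mod_le: "m \<le> n \<Longrightarrow> res3 x n mod 3 ^ m = res3 x m"
proof (induction n rule: dec_induct)
  case (step n)
  have "res3 x (Suc n) mod 3 ^ m = res3 x (Suc n) mod 3 ^ n mod 3 ^ m"
    by (rule mod_mod_cancel [symmetric]) (simp add: le_imp_power_dvd step)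
  then show ?case
    by (simp add: res3_Suc_mod step)
qed simp

instantiation zadic3 :: comm_ring_1
begin

lift_definition zero_zadic3 :: zadic3 is "\<lambda>_. 0"
  by simp

lift_definition one_zadic3 :: zadic3 is "\<lambda>n. 1 mod 3 ^ n"
  by (auto simp del: power_Suc simp: mod_3_power_Suc_cancel)

lift_definition plus_zadic3 :: "zadic3 \<Rightarrow> zadic3 \<Rightarrow> zadic3" is "\<lambda>x y n. (x n + y n) mod 3 ^ n"
  by (auto simp del: power_Suc simp: mod_3_power_Suc_cancel) (metis mod_add_eq)

lift_definition uminus_zadic3 :: "zadic3 \<Rightarrow> zadic3" is "\<lambda>x n. (- x n) mod 3 ^ n"
  by (auto simp del: power_Suc simp: mod_3_power_Suc_cancel) (metis mod_minus_eq)

lift_definition minus_zadic3 :: "zadic3 \<Rightarrow> zadic3 \<Rightarrow> zadic3" is "\<lambda>x y n. (x n - y n) mod 3 ^ n"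
  by (auto simp del: power_Suc simp: mod_3_power_Suc_cancel) (metis mod_diff_eq)

lift_definition times_zadic3 :: "zadic3 \<Rightarrow> zadic3 \<Rightarrow> zadic3" is "\<lambda>x y n. (x n * y n) mod 3 ^ n"
  by (auto simp del: power_Suc simp: mod_3_power_Suc_cancel) (metis mod_mult_eq)

instance
proof
  fix a b c :: zadic3
  show "a * b * c = a * (b * c)"
    by (rule zadic3_eqI) (simp add: times_zadic3.rep_eq mod_simps mult.assoc)
  show "a * b = b * a"
    by (rule zadic3_eqI) (simp add: times_zadic3.rep_eq mult.commute)
  show "1 * a = a"
    by (rule zadic3_eqI) (simp add: times_zadic3.rep_eq one_zadic3.rep_eq mod_simps)
  show "a + b + c = a + (b + c)"
    by (rule zadic3_eqI) (simp add: plus_zadic3.rep_eq mod_simps add.assoc)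
  show "a + b = b + a"
    by (rule zadic3_eqI) (simp add: plus_zadic3.rep_eq add.commute)
  show "0 + a = a"
    by (rule zadic3_eqI) (simp add: plus_zadic3.rep_eq zero_zadic3.rep_eq)
  show "- a + a = 0"
    by (rule zadic3_eqI) (simp add: plus_zadic3.rep_eq uminus_zadic3.rep_eq zero_zadic3.rep_eq mod_simps)
  show "a - b = a + - b"
    by (rule zadic3_eqI) (simp add: plus_zadic3.rep_eq uminus_zadic3.rep_eq minus_zadic3.rep_eq mod_simps)
  show "(a + b) * c = a * c + b * c"
    by (rule zadic3_eqI)
      (simp add: plus_zadic3.rep_eq times_zadic3.rep_eq mod_simps distrib_right)
  have "res3 (0 :: zadic3) 1 \<noteq> res3 1 1"
    by (simp add: zero_zadic3.rep_eq one_zadic3.rep_eq)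
  then show "(0 :: zadic3) \<noteq> 1"
    by metis
qed

end

lemma res3_of_nat: "res3 (of_nat k) n = int k mod 3 ^ n"
  by (induction k)
    (simp_all add: zero_zadic3.rep_eq one_zadic3.rep_eq plus_zadic3.rep_eq mod_simps)

lemma of_nat_zadic3_inject: "of_nat a = (of_nat b :: zadic3) \<longleftrightarrow> a = b"
proof
  assume eq: "of_nat a = (of_nat b :: zadic3)"
  have "a < 3 ^ (a + b)" "b < 3 ^ (a + b)"
    using power_gt_expt[of 3 "a + b"] by linarith+
  then have "int a mod 3 ^ (a + b) = int a" "int b mod 3 ^ (a + b) = int b"
    by (auto simp flip: of_nat_less_iff)
  then show "a = b"
    using arg_cong[OF eq, of "\<lambda>x. res3 x (a + b)"] by (simp add: res3_of_nat)
qed simp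

text \<open>
  The 3-adic metric: \<open>dist x y = 3^(-n)\<close>, where \<open>n\<close> is the largest exponent with
  \<open>x \<equiv> y (mod 3^n)\<close>.
\<close>

instantiation zadic3 :: metric_space
begin

definition dist_zadic3 :: "zadic3 \<Rightarrow> zadic3 \<Rightarrow> real" where
  "dist_zadic3 x y = (if x = y then 0 else (1/3) ^ (GREATEST n. res3 x n = res3 y n))"

definition uniformity_zadic3 :: "(zadic3 \<times> zadic3) filter" where
  "uniformity_zadic3 = (INF e\<in>{0<..}. principal {(x, y). dist x y < e})"

definition open_zadic3 :: "zadic3 set \<Rightarrow> bool" where
  "open_zadic3 U = (\<forall>x\<in>U. eventually (\<lambda>(x', y). x' = x \<longrightarrow> y \<in> U) uniformity)"

lemma res3_eq_le: "res3 x n = res3 y n \<Longrightarrow> m \<le> n \<Longrightarrow> res3 x m = res3 y m"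
  by (metis res3_mod_le)

lemma dist_zadic3_le_iff: "dist (x :: zadic3) y \<le> (1/3) ^ n \<longleftrightarrow> res3 x n = res3 y n"
proof (cases "x = y")
  case True
  then show ?thesis by (simp add: dist_zadic3_def)
next
  case False
  then obtain b where b: "res3 x b \<noteq> res3 y b"
    using zadic3_eqI by blast
  let ?P = "\<lambda>n. res3 x n = res3 y n"
  have bound: "\<forall>m. ?P m \<longrightarrow> m \<le> b"
    using b res3_eq_le by (metis nat_le_linear)
  have 1: "?P (Greatest ?P)"
    by (rule GreatestI_nat[where P = ?P and b = b, of 0]) (use bound in auto)
  have 2: "?P m \<Longrightarrow> m \<le> Greatest ?P" for m
    by (rule Greatest_le_nat[where P = ?P and b = b]) (use bound in auto)
  have "?P n \<longleftrightarrow> n \<le> Greatest ?P"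
    using 1 2 res3_eq_le by blast
  then show ?thesis
    using False by (simp add: dist_zadic3_def power_decreasing_iff)
qed

lemma dist_zadic3_cases: "dist x y = 0 \<and> x = y \<or> (\<exists>n. dist (x :: zadic3) y = (1/3) ^ n)"
  by (auto simp: dist_zadic3_def)

lemma dist_zadic3_ultra: "dist (x :: zadic3) y \<le> max (dist x z) (dist y z)"
proof (cases "x = z \<or> y = z")
  case True
  have "dist x y = dist y x"
    by (simp add: dist_zadic3_def eq_commute[of x y] eq_commute[of "res3 x _"])
  with True show ?thesis by auto
next
  case False
  then obtain m n where mn: "dist x z = (1/3) ^ m" "dist y z = (1/3) ^ n"
    using dist_zadic3_cases[of x z] dist_zadic3_cases[of y z] by blast
  have "res3 x m = res3 z m" "res3 y n = res3 z n"
    unfolding dist_zadic3_le_iff[symmetric] mn by (rule order_refl)+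
  then have "res3 x (min m n) = res3 y (min m n)"
    using res3_eq_le[of x m z "min m n"] res3_eq_le[of y n z "min m n"] by simp
  then have "dist x y \<le> (1/3) ^ min m n"
    unfolding dist_zadic3_le_iff .
  also have "\<dots> \<le> max (dist x z) (dist y z)"
    unfolding mn by (cases "m \<le> n") (auto simp: min_def)
  finally show ?thesis .
qed

instance
proof
  fix x y z :: zadic3
  show "dist x y = 0 \<longleftrightarrow> x = y"
    by (simp add: dist_zadic3_def)
  have nonneg: "0 \<le> dist a b" for a b :: zadic3
    by (simp add: dist_zadic3_def)
  show "dist x y \<le> dist x z + dist y z"
    using dist_zadic3_ultra[of x y z] nonneg[of x z] nonneg[of y z] by linarith
qed (simp_all add: uniformity_zadic3_def open_zadic3_def)

end

lemma bounded_zadic3 [simp]: "bounded (S :: zadic3 set)"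
proof -
  have "\<forall>y\<in>S. dist 0 y \<le> 1"
    using dist_zadic3_le_iff[of 0 _ 0] by simp
  then show ?thesis
    unfolding bounded_def by blast
qed

lemma diameter_residue_class: "diameter {y. res3 y j = res3 x j} = (1/3) ^ j"
proof (rule antisym)
  let ?C = "{y. res3 y j = res3 x j}"
  have "x \<in> ?C" by simp
  then have ne: "?C \<noteq> {}" by blast
  have "dist y z \<le> (1/3) ^ j" if "y \<in> ?C" "z \<in> ?C" for y z
    using that by (simp add: dist_zadic3_le_iff)
  then show "diameter ?C \<le> (1/3) ^ j"
    unfolding diameter_def using ne by (auto intro!: cSUP_least)
  let ?y = "x + of_nat (3 ^ j)"
  have r: "res3 ?y n = (res3 x n + 3 ^ j) mod 3 ^ n" for n
    by (simp only: plus_zadic3.rep_eq res3_of_nat) (simp add: mod_simps)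
  have yC: "?y \<in> ?C"
    unfolding mem_Collect_eq r by simp
  have "res3 ?y (Suc j) \<noteq> res3 x (Suc j)"
  proof
    assume "res3 ?y (Suc j) = res3 x (Suc j)"
    then have "(res3 x (Suc j) + 3 ^ j) mod 3 ^ Suc j = res3 x (Suc j) mod 3 ^ Suc j"
      unfolding r by (simp only: res3_mod_self)
    then have "(3 ^ Suc j :: int) dvd 3 ^ j"
      by (metis add_diff_cancel_left' mod_eq_dvd_iff)
    then show False
      by (simp add: dvd_power_iff)
  qed
  then have gt: "\<not> dist ?y x \<le> (1/3) ^ Suc j" and "?y \<noteq> x"
    unfolding dist_zadic3_le_iff by metis+
  then obtain n where n: "dist ?y x = (1/3) ^ n"
    using dist_zadic3_cases by blast
  have "n < Suc j"
  proof (rule ccontr)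
    assume "\<not> n < Suc j"
    then have "(1/3 :: real) ^ n \<le> (1/3) ^ Suc j"
      by (intro power_decreasing) auto
    with gt n show False by simp
  qed
  then have "(1/3) ^ j \<le> dist ?y x"
    unfolding n by (intro power_decreasing) auto
  also have "\<dots> \<le> diameter ?C"
    using yC by (intro diameter_bounded_bound) auto
  finally show "(1/3) ^ j \<le> diameter ?C" .
qed

section \<open>Hausdorff dimension\<close>

text \<open>
  In dimension \<open>0\<close> every nonempty set has size \<open>1\<close>
  (whereas \<open>0 powr 0 = 0\<close> in the library).
\<close>

definition hausdorff_gauge :: "real \<Rightarrow> 'a::metric_space set \<Rightarrow> ennreal" where
  "hausdorff_gauge s U =
     (if U = {} then 0 else if s = 0 then 1 else ennreal (diameter U powr s))"

definition hausdorff_premeasure :: "real \<Rightarrow> real \<Rightarrow> 'a::metric_space set \<Rightarrow> ennreal" where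
  "hausdorff_premeasure s \<delta> A =
     (INF U\<in>{U :: nat \<Rightarrow> 'a set. A \<subseteq> (\<Union>i. U i) \<and> (\<forall>i. bounded (U i) \<and> diameter (U i) \<le> \<delta>)}.
        \<Sum>i. hausdorff_gauge s (U i))"

definition hausdorff_measure :: "real \<Rightarrow> 'a::metric_space set \<Rightarrow> ennreal" where
  "hausdorff_measure s A = (SUP \<delta>\<in>{0<..}. hausdorff_premeasure s \<delta> A)"

definition hausdorff_dim :: "'a::metric_space set \<Rightarrow> ennreal" where
  "hausdorff_dim A = (INF s\<in>{s. 0 \<le> s \<and> hausdorff_measure s A = 0}. ennreal s)"

section \<open>The 3-adic Cantor set\<close>

definition is_expansion3 :: "(nat \<Rightarrow> nat) \<Rightarrow> zadic3 \<Rightarrow> bool" where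
  "is_expansion3 d x \<longleftrightarrow> (\<forall>j. d j \<in> {0, 1, 2}) \<and> (\<lambda>j. of_nat (d j) * 3 ^ j) sums x"

lemma digit_sum_less:
  "(\<And>j. d j \<in> {0, 1, 2 :: nat}) \<Longrightarrow> (\<Sum>j<m. d j * 3 ^ j) < 3 ^ m"
proof (induction m)
  case (Suc m)
  have "d m \<le> 2"
    using Suc.prems[of m] by auto
  then have "d m * 3 ^ m \<le> 2 * 3 ^ m"
    by (rule mult_le_mono1)
  moreover have "(\<Sum>j<m. d j * 3 ^ j) < 3 ^ m"
    using Suc by blast
  ultimately show ?case
    unfolding sum.lessThan_Suc power_Suc by linarith
qed simp

lemma digit_sum_mod:
  assumes "\<And>j. d j \<in> {0, 1, 2 :: nat}" and "m \<le> n"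
  shows "(\<Sum>j<n. d j * 3 ^ j) mod 3 ^ m = (\<Sum>j<m. d j * 3 ^ j)"
  using assms(2)
proof (induction n rule: dec_induct)
  case base
  then show ?case using digit_sum_less[of d m] assms(1) by simp
next
  case (step n)
  have "(3 :: nat) ^ m dvd d n * 3 ^ n"
    using step by (simp add: le_imp_power_dvd)
  then have "((\<Sum>j<n. d j * 3 ^ j) + d n * 3 ^ n) mod 3 ^ m = (\<Sum>j<n. d j * 3 ^ j) mod 3 ^ m"
    by (metis add.right_neutral dvd_imp_mod_0 mod_add_right_eq)
  then show ?case
    using step by simp
qed

lemma is_expansion3_iff:
  "is_expansion3 d x \<longleftrightarrow>
     (\<forall>j. d j \<in> {0, 1, 2}) \<and> (\<forall>m. res3 x m = int (\<Sum>j<m. d j * 3 ^ j))"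
proof (cases "\<forall>j. d j \<in> {0, 1, 2}")
  case True
  define S where "S = (\<lambda>n. \<Sum>j<n. of_nat (d j) * 3 ^ j :: zadic3)"
  have S: "S n = of_nat (\<Sum>j<n. d j * 3 ^ j)" for n
    by (simp add: S_def)
  have res: "res3 (S n) m = int (\<Sum>j<m. d j * 3 ^ j)" if "m \<le> n" for m n
  proof -
    have "res3 (S n) m = int ((\<Sum>j<n. d j * 3 ^ j) mod 3 ^ m)"
      unfolding S res3_of_nat zmod_int by simp
    then show ?thesis
      using digit_sum_mod[of d m n] that True by simp
  qed
  have "S \<longlonglongrightarrow> x \<longleftrightarrow> (\<forall>m. res3 x m = int (\<Sum>j<m. d j * 3 ^ j))"
  proof (intro iffI allI)
    fix m assume "S \<longlonglongrightarrow> x"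
    then obtain k where "\<forall>n\<ge>k. dist (S n) x < (1/3) ^ m"
      by (auto dest: metric_LIMSEQ_D[where r = "(1/3) ^ m"])
    then have "dist (S (max k m)) x \<le> (1/3) ^ m"
      by (simp add: less_imp_le)
    then show "res3 x m = int (\<Sum>j<m. d j * 3 ^ j)"
      unfolding dist_zadic3_le_iff by (simp only: res max.cobounded2)
  next
    assume x: "\<forall>m. res3 x m = int (\<Sum>j<m. d j * 3 ^ j)"
    have le: "dist (S n) x \<le> (1/3) ^ n" for n
      unfolding dist_zadic3_le_iff by (simp only: res x order_refl)
    have "(\<lambda>n. (1/3 :: real) ^ n) \<longlonglongrightarrow> 0"
      by (rule LIMSEQ_power_zero) simp
    then have "(\<lambda>n. dist (S n) x) \<longlonglongrightarrow> 0"
      by (rule tendsto_sandwich[of "\<lambda>_. 0", rotated 3]) (auto simp: le)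
    then show "S \<longlonglongrightarrow> x"
      using tendsto_dist_iff by blast
  qed
  with True show ?thesis
    by (simp only: is_expansion3_def sums_def S_def simp_thms)
qed (unfold is_expansion3_def, blast)

lemma ex1_expansion3: "\<exists>!d. is_expansion3 d x"
proof (rule ex_ex1I)
  define d where "d j = nat (res3 x (Suc j) div 3 ^ j)" for j
  have int_d: "int (d j) = res3 x (Suc j) div 3 ^ j" for j
    by (simp add: d_def res3_nonneg pos_imp_zdiv_nonneg_iff)
  have "res3 x (Suc j) div 3 ^ j < 3" for j
  proof (rule ccontr)
    assume "\<not> res3 x (Suc j) div 3 ^ j < 3"
    then have "3 * 3 ^ j \<le> res3 x (Suc j) div 3 ^ j * 3 ^ j"
      by (intro mult_right_mono) auto
    also have "\<dots> \<le> res3 x (Suc j)"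
      using div_mult_mod_eq[of "res3 x (Suc j)" "3 ^ j"] res3_nonneg[of x j]
      unfolding res3_Suc_mod by linarith
    finally show False
      using res3_less[of x "Suc j"] by simp
  qed
  then have "d j < 3" for j
    using int_d[of j] by (metis of_nat_less_iff of_nat_numeral)
  moreover have "a < 3 \<Longrightarrow> a \<in> {0, 1, 2 :: nat}" for a
    by auto
  ultimately have "d j \<in> {0, 1, 2}" for j
    by blast
  moreover have "res3 x m = int (\<Sum>j<m. d j * 3 ^ j)" for m
  proof (induction m)
    case (Suc m)
    have "res3 x (Suc m) = res3 x (Suc m) div 3 ^ m * 3 ^ m + res3 x (Suc m) mod 3 ^ m"
      by (rule div_mult_mod_eq [symmetric])
    also have "\<dots> = int (d m) * 3 ^ m + res3 x m"
      by (simp only: int_d res3_Suc_mod)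
    finally show ?case
      using Suc by simp
  qed simp
  ultimately show "\<exists>d. is_expansion3 d x"
    unfolding is_expansion3_iff by blast
next
  fix d e assume "is_expansion3 d x" "is_expansion3 e x"
  then have eq: "(\<Sum>j<m. d j * 3 ^ j) = (\<Sum>j<m. e j * 3 ^ j)" for m
    unfolding is_expansion3_iff by (metis of_nat_eq_iff)
  show "d = e"
  proof
    fix j
    show "d j = e j"
      using eq[of j] eq[of "Suc j"] by simp
  qed
qed

definition cantor3 :: "zadic3 set" where
  "cantor3 = {x. \<exists>d. is_expansion3 d x \<and> (\<forall>j. d j \<noteq> 2)}"

definition cantor3_intersection :: "nat \<Rightarrow> (nat \<Rightarrow> nat) \<Rightarrow> zadic3 set" where
  "cantor3_intersection k M = {x. \<forall>i\<in>{1..k}. of_nat (M i) * x \<in> cantor3}"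

end

theory Submission
  imports Defs
begin

text \<open>
  With \<open>L = \<lceil>log\<^sub>3 (N M\<^sub>k)\<rceil>\<close>, every \<open>N M\<^sub>i\<close> either fits into \<open>L\<close> base 3 digits or equals \<open>3 ^ L\<close>.
  Hence \<open>\<lambda> = N \<Sum> e\<^sub>j 3\<^bsup>L j\<^esup>\<close> lies in the intersection set for every choice of bits \<open>e\<^sub>j\<close>, as the
  digit blocks in \<open>M\<^sub>i \<lambda>\<close> do not overlap. Taking for \<open>e\<^sub>j\<close> the binary digits of \<open>u \<in> [0, 1)\<close>
  gives a map into the set whose inverse is Hoelder continuous with exponent \<open>log\<^sub>3 2 / L\<close>, and
  countable subadditivity of Lebesgue measure on \<open>[0, 1)\<close> bounds the size of every cover from below.
\<close>

section \<open>A lower bound for Hausdorff dimension\<close>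

text \<open>For diameters at most 1, powers decrease in the exponent. The convention
  \<open>0 powr t = 0\<close> settles the empty set, and the bound by 1 settles
  \<open>s = 0\<close>.\<close>

lemma hausdorff_gauge_ge_powr:
  assumes "0 \<le> s" "s \<le> t" "bounded U" "diameter U \<le> 1"
  shows "ennreal (diameter U powr t) \<le> hausdorff_gauge s U"
proof -
  have "0 \<le> diameter U"
    using assms(3) by (rule diameter_ge_0)
  then have "diameter U powr t \<le> diameter U powr s" "diameter U powr t \<le> 1"
    using assms by (cases "diameter U = 0"; simp add: powr_mono' powr_le1)+
  then show ?thesis
    by (auto simp: hausdorff_gauge_def intro: ennreal_leI)
qed

text \<open>A form of the mass distribution principle: by \<open>expand\<close>, the preimage under
  \<open>g\<close> of a set of diameter \<open>d\<close> lies in an interval of length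
  \<open>2 * K * d powr t\<close>. Enclosing balls stand in for the preimages, which may fail to be
  measurable.\<close>

lemma hausdorff_dim_ge_expanding:
  fixes g :: "real \<Rightarrow> 'a :: metric_space"
  assumes gA: "g ` {0..<1} \<subseteq> A" and "0 < K" and "0 \<le> t"
    and expand: "\<And>u v. u \<in> {0..<1} \<Longrightarrow> v \<in> {0..<1} \<Longrightarrow> \<bar>u - v\<bar> \<le> K * dist (g u) (g v) powr t"
  shows "ennreal t \<le> hausdorff_dim A"
  unfolding hausdorff_dim_def
proof (rule INF_greatest)
  fix s assume "s \<in> {s. 0 \<le> s \<and> hausdorff_measure s A = 0}"
  then have s: "0 \<le> s" and null: "hausdorff_measure s A = 0"
    by auto
  show "ennreal t \<le> ennreal s"
  proof (rule ccontr)
    assume "\<not> ennreal t \<le> ennreal s"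
    then have "s \<le> t"
      by (metis ennreal_leI linorder_linear)
    \<comment> \<open>Scale 1 keeps the diameters in the range of
      \<open>hausdorff_gauge_ge_powr\<close>. The threshold \<open>1 / (2 * K)\<close> below is
      chosen so that the balls get total length less than 1.\<close>
    have "hausdorff_premeasure s 1 A \<le> hausdorff_measure s A"
      unfolding hausdorff_measure_def by (rule SUP_upper) simp
    then have "hausdorff_premeasure s 1 A < ennreal (1 / (2 * K))"
      using null \<open>0 < K\<close> by simp
    then obtain U :: "nat \<Rightarrow> 'a set" where cover: "A \<subseteq> (\<Union>i. U i)"
      and U: "\<And>i. bounded (U i)" "\<And>i. diameter (U i) \<le> 1"
      and small: "(\<Sum>i. hausdorff_gauge s (U i)) < ennreal (1 / (2 * K))"
      unfolding hausdorff_premeasure_def INF_less_iff by auto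
    define r where "r i = K * diameter (U i) powr t" for i
    have r: "0 \<le> r i" for i
      using \<open>0 < K\<close> by (simp add: r_def)
    have "\<exists>c. {u \<in> {0..<1}. g u \<in> U i} \<subseteq> cball c (r i)" for i
    proof (cases "{u \<in> {0..<1}. g u \<in> U i} = {}")
      case False
      then obtain c where c: "c \<in> {0..<1}" "g c \<in> U i"
        by blast
      have "u \<in> cball c (r i)" if "u \<in> {0..<1}" "g u \<in> U i" for u
      proof -
        have "dist (g c) (g u) \<le> diameter (U i)"
          using U(1) c(2) that(2) by (rule diameter_bounded_bound)
        then have "K * dist (g c) (g u) powr t \<le> r i"
          unfolding r_def using \<open>0 < K\<close> \<open>0 \<le> t\<close> by (intro mult_left_mono powr_mono2) auto
        then show ?thesis
          using expand[OF c(1) that(1)] by (simp add: dist_real_def)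
      qed
      then show ?thesis by blast
    qed auto
    then obtain c where c: "\<And>i. {u \<in> {0..<1}. g u \<in> U i} \<subseteq> cball (c i) (r i)"
      by metis
    have "{0..<1} \<subseteq> (\<Union>i. cball (c i) (r i))"
    proof
      fix u :: real assume u: "u \<in> {0..<1}"
      then obtain i where "g u \<in> U i"
        using gA cover by blast
      then show "u \<in> (\<Union>i. cball (c i) (r i))"
        using c[of i] u by blast
    qed
    then have "emeasure lborel {0..<1::real} \<le> emeasure lborel (\<Union>i. cball (c i) (r i))"
      by (intro emeasure_mono) auto
    also have "\<dots> \<le> (\<Sum>i. emeasure lborel (cball (c i) (r i)))"
      by (rule emeasure_subadditive_countably) auto
    also have "\<dots> \<le> (\<Sum>i. ennreal (2 * K) * hausdorff_gauge s (U i))"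
    proof (rule suminf_le)
      fix i
      have "emeasure lborel (cball (c i) (r i)) = ennreal (2 * K) * ennreal (diameter (U i) powr t)"
        using r[of i] \<open>0 < K\<close>
        by (simp add: cball_eq_atLeastAtMost r_def mult.assoc flip: ennreal_mult)
      also have "\<dots> \<le> ennreal (2 * K) * hausdorff_gauge s (U i)"
        using hausdorff_gauge_ge_powr[OF s \<open>s \<le> t\<close> U] by (rule mult_left_mono) simp
      finally show "emeasure lborel (cball (c i) (r i)) \<le> \<dots>" .
    qed auto
    also have "\<dots> = ennreal (2 * K) * (\<Sum>i. hausdorff_gauge s (U i))"
      by simp
    also have "\<dots> < ennreal (2 * K) * ennreal (1 / (2 * K))"
      using small \<open>0 < K\<close> by (intro ennreal_mult_strict_left_mono) auto
    also have "\<dots> = 1"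
      using \<open>0 < K\<close> by (simp flip: ennreal_mult)
    finally show False
      by simp
  qed
qed

section \<open>Digits\<close>

definition omits_two :: "int \<Rightarrow> bool" where
  "omits_two a \<longleftrightarrow> (\<forall>j. a div 3 ^ j mod 3 \<noteq> 2)"

lemma mod_power_Suc_div: "(a :: int) mod 3 ^ Suc j div 3 ^ j = a div 3 ^ j mod 3"
  by (simp add: zmod_zmult2_eq mult.commute[of 3])

text \<open>Replaces the series by finite residues: the residue modulo \<open>3 ^ Suc j\<close> is a
  number below \<open>3 ^ j\<close> plus \<open>d j * 3 ^ j\<close>, so the quotient is the digit
  \<open>d j\<close>.\<close>

lemma cantor3_iff: "x \<in> cantor3 \<longleftrightarrow> (\<forall>j. res3 x (Suc j) div 3 ^ j \<noteq> 2)"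
proof -
  obtain d where d: "is_expansion3 d x" and unique: "\<And>e. is_expansion3 e x \<Longrightarrow> e = d"
    using ex1_expansion3[of x] by blast
  have "res3 x (Suc j) div 3 ^ j = int (d j)" for j
  proof -
    have "res3 x (Suc j) = res3 x j + int (d j) * 3 ^ j"
      using d unfolding is_expansion3_iff by simp
    then show ?thesis
      using res3_nonneg[of x j] res3_less[of x j] by simp
  qed
  moreover have "x \<in> cantor3 \<longleftrightarrow> (\<forall>j. d j \<noteq> 2)"
    unfolding cantor3_def using d unique by blast
  ultimately show ?thesis
    by simp
qed

lemma of_nat_in_cantor3_iff: "of_nat a \<in> cantor3 \<longleftrightarrow> omits_two (int a)"
  by (simp add: cantor3_iff omits_two_def res3_of_nat mod_power_Suc_div del: power_Suc)

lemma omits_two_0: "omits_two 0"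
  by (simp add: omits_two_def)

lemma omits_two_1: "omits_two 1"
  unfolding omits_two_def
proof
  fix j
  show "(1 :: int) div 3 ^ j mod 3 \<noteq> 2"
    by (cases "j = 0") simp_all
qed

text \<open>The digits of \<open>a\<close> end before position \<open>m\<close>, where those of the
  shifted \<open>b\<close> begin, so no carry occurs.\<close>

lemma omits_two_append:
  assumes "omits_two a" "omits_two b" "0 \<le> a" "a < 3 ^ m"
  shows "omits_two (a + b * 3 ^ m)"
  unfolding omits_two_def
proof
  fix j
  show "(a + b * 3 ^ m) div 3 ^ j mod 3 \<noteq> 2"
  proof (cases "j < m")
    case True
    then obtain i where "m = j + Suc i"
      using less_imp_Suc_add by auto
    then have "(a + b * 3 ^ m) div 3 ^ j = a div 3 ^ j + 3 * (b * 3 ^ i)"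
      by (simp add: power_add div_plus_div_distrib_dvd_right)
    then show ?thesis
      using assms(1) by (simp add: omits_two_def)
  next
    case False
    then obtain i where j: "j = m + i"
      using le_Suc_ex not_less by blast
    have "(a + b * 3 ^ m) div 3 ^ j = (a + b * 3 ^ m) div 3 ^ m div 3 ^ i"
      by (simp add: j power_add zdiv_zmult2_eq)
    also have "(a + b * 3 ^ m) div 3 ^ m = b"
      using assms(3,4) by simp
    finally show ?thesis
      using assms(2) by (simp add: omits_two_def)
  qed
qed

section \<open>Sparse 3-adic integers\<close>

definition block_sum :: "nat \<Rightarrow> (nat \<Rightarrow> bool) \<Rightarrow> nat \<Rightarrow> int" where
  "block_sum L e n = (\<Sum>j<n. of_bool (e j) * 3 ^ (L * j))"

lemma block_sum_Suc: "block_sum L e (Suc n) = block_sum L e n + of_bool (e n) * 3 ^ (L * n)"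
  by (simp add: block_sum_def)

lemma block_sum_nonneg: "0 \<le> block_sum L e n"
  by (simp add: block_sum_def sum_nonneg)

lemma block_sum_mod:
  assumes "m \<le> n"
  shows "block_sum L e n mod 3 ^ (L * m) = block_sum L e m mod 3 ^ (L * m)"
  using assms
proof (induction n rule: dec_induct)
  case (step n)
  then have "(3 :: int) ^ (L * m) dvd of_bool (e n) * 3 ^ (L * n)"
    by (intro dvd_mult le_imp_power_dvd) simp
  then show ?case
    using step by (metis block_sum_Suc dvd_imp_mod_0 mod_add_right_eq add.right_neutral)
qed simp

text \<open>Each term \<open>P * of_bool (e j)\<close> is at most \<open>3 ^ L - 1\<close> and so
  stays within its own block of \<open>L\<close> digits.\<close>

lemma block_sum_mult_less:
  assumes "0 \<le> P" "P < 3 ^ L"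
  shows "P * block_sum L e n < 3 ^ (L * n)"
proof (induction n)
  case (Suc n)
  have "P * of_bool (e n) \<le> 3 ^ L - 1"
    using assms by (cases "e n") auto
  then have "P * of_bool (e n) * 3 ^ (L * n) \<le> (3 ^ L - 1) * 3 ^ (L * n)"
    by (rule mult_right_mono) simp
  then show ?case
    using Suc by (simp add: block_sum_Suc algebra_simps power_add)
qed (simp add: block_sum_def)

lemma block_sum_less:
  assumes "0 < L"
  shows "block_sum L e n < 3 ^ (L * n)"
  using block_sum_mult_less[of 1 L e n] assms by simp

lemma omits_two_mult_block_sum:
  assumes "0 \<le> P" "P \<le> 3 ^ L" "omits_two P" "0 < L"
  shows "omits_two (P * block_sum L e n)"
proof -
  have less: "omits_two (Q * block_sum L e n)" if "0 \<le> Q" "Q < 3 ^ L" "omits_two Q" for Q n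
  proof (induction n)
    case (Suc n)
    have "omits_two (Q * block_sum L e n + Q * of_bool (e n) * 3 ^ (L * n))"
      using that Suc
      by (intro omits_two_append block_sum_mult_less mult_nonneg_nonneg block_sum_nonneg)
        (auto simp: omits_two_0)
    then show ?case
      by (simp add: block_sum_Suc algebra_simps)
  qed (simp add: block_sum_def omits_two_0)
  show ?thesis
  proof (cases "P = 3 ^ L")
    \<comment> \<open>\<open>3 ^ L\<close> has one digit too many for a block, but multiplying by it
      only shifts the block sum, which is itself covered by \<open>less\<close> with
      \<open>Q = 1\<close>.\<close>
    case True
    have "omits_two (1 * block_sum L e n)"
      using \<open>0 < L\<close> by (intro less) (auto simp: omits_two_1)
    then have "omits_two (0 + block_sum L e n * 3 ^ L)"
      by (intro omits_two_append) (auto simp: omits_two_0)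
    then show ?thesis
      by (simp add: True mult.commute)
  next
    case False
    then show ?thesis
      using assms less by simp
  qed
qed

text \<open>Junk for \<open>L = 0\<close>, where the residues are not compatible.\<close>

definition sparse3 :: "nat \<Rightarrow> (nat \<Rightarrow> bool) \<Rightarrow> zadic3" where
  "sparse3 L e = Abs_zadic3 (\<lambda>m. block_sum L e m mod 3 ^ m)"

lemma res3_sparse3:
  assumes "0 < L"
  shows "res3 (sparse3 L e) m = block_sum L e m mod 3 ^ m"
proof -
  have "block_sum L e (Suc n) mod 3 ^ Suc n mod 3 ^ n = block_sum L e n mod 3 ^ n" for n
  proof -
    have "(3 :: int) ^ n dvd of_bool (e n) * 3 ^ (L * n)"
      using assms by (intro dvd_mult le_imp_power_dvd) simp
    then show ?thesis
      by (metis mod_3_power_Suc_cancel block_sum_Suc dvd_imp_mod_0 mod_add_right_eq add.right_neutral)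
  qed
  then show ?thesis
    unfolding sparse3_def by (subst Abs_zadic3_inverse) (auto simp del: power_Suc)
qed

lemma res3_sparse3_block:
  assumes "0 < L"
  shows "res3 (sparse3 L e) (L * n) = block_sum L e n"
proof -
  \<comment> \<open>The residue is built from \<open>L * n\<close> bits; modulo
    \<open>3 ^ (L * n)\<close> only the first \<open>n\<close> of them survive.\<close>
  have "n \<le> L * n"
    using assms by simp
  then have "res3 (sparse3 L e) (L * n) = block_sum L e n mod 3 ^ (L * n)"
    unfolding res3_sparse3[OF assms] by (rule block_sum_mod)
  then show ?thesis
    using block_sum_less[OF assms] block_sum_nonneg by simp
qed

lemma mult_sparse3_in_cantor3:
  assumes "of_nat P \<in> cantor3" "P \<le> 3 ^ L" "0 < L"
  shows "of_nat P * sparse3 L e \<in> cantor3"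
  unfolding cantor3_iff
proof
  fix j
  have "int P \<le> 3 ^ L"
    using assms(2) by (metis of_nat_le_iff of_nat_numeral of_nat_power)
  then have "omits_two (int P * block_sum L e (Suc j))"
    using assms by (intro omits_two_mult_block_sum) (auto simp: of_nat_in_cantor3_iff)
  moreover have "res3 (of_nat P * sparse3 L e) (Suc j) = int P * block_sum L e (Suc j) mod 3 ^ Suc j"
    by (simp only: times_zadic3.rep_eq res3_of_nat res3_sparse3[OF assms(3)] mod_mult_eq)
  ultimately show "res3 (of_nat P * sparse3 L e) (Suc j) div 3 ^ j \<noteq> 2"
    by (simp only: mod_power_Suc_div omits_two_def simp_thms)
qed

text \<open>The loss of \<open>N\<close> digits is a crude bound for the 3-adic valuation of \<open>N\<close>.\<close>

lemma res3_mult_of_nat_cancel: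
  assumes "0 < N" "res3 (of_nat N * x) (n + N) = res3 (of_nat N * y) (n + N)"
  shows "res3 x n = res3 y n"
proof -
  have "int N * res3 x (n + N) mod 3 ^ (n + N) = int N * res3 y (n + N) mod 3 ^ (n + N)"
    using assms(2) by (simp add: times_zadic3.rep_eq res3_of_nat mod_simps)
  then have dvd: "3 ^ (n + N) dvd int N * (res3 x (n + N) - res3 y (n + N))"
    by (simp add: mod_eq_dvd_iff right_diff_distrib)
  have "(3 :: int) ^ n dvd res3 x (n + N) - res3 y (n + N)" (is "_ dvd ?z")
  proof (cases "?z = 0")
    case False
    have p: "prime_elem (3 :: int)"
      by simp
    have "n + N \<le> multiplicity 3 (int N * ?z)"
      using dvd False assms(1) by (intro multiplicity_geI) auto
    also have "\<dots> = multiplicity 3 (int N) + multiplicity 3 ?z"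
      using False assms(1) by (intro prime_elem_multiplicity_mult_distrib p) auto
    finally have le: "n + N \<le> multiplicity 3 (int N) + multiplicity 3 ?z" .
    have "3 ^ multiplicity 3 (int N) \<le> int N"
      using assms(1) by (intro zdvd_imp_le multiplicity_dvd) simp
    moreover have "int (multiplicity 3 (int N)) < 3 ^ multiplicity 3 (int N)"
      using power_gt_expt[of 3 "multiplicity 3 (int N)"] by simp
    ultimately have "n \<le> multiplicity 3 ?z"
      using le by linarith
    then show ?thesis
      by (rule multiplicity_dvd')
  qed simp
  then have "res3 x (n + N) mod 3 ^ n = res3 y (n + N) mod 3 ^ n"
    by (simp add: mod_eq_dvd_iff)
  then show ?thesis
    by (simp add: res3_mod_le)
qed

section \<open>The dimension bound\<close>

definition binary_digit :: "real \<Rightarrow> nat \<Rightarrow> bool" where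
  "binary_digit u j \<longleftrightarrow> odd \<lfloor>2 ^ Suc j * u\<rfloor>"

lemma floor_power_Suc: "\<lfloor>2 ^ Suc n * u\<rfloor> = 2 * \<lfloor>2 ^ n * u\<rfloor> + of_bool (binary_digit u n)"
proof -
  have "\<lfloor>2 ^ Suc n * u\<rfloor> div 2 = \<lfloor>2 ^ Suc n * u / 2\<rfloor>"
    using floor_divide_real_eq_div[of 2 "2 ^ Suc n * u"] by simp
  then have "\<lfloor>2 ^ Suc n * u\<rfloor> div 2 = \<lfloor>2 ^ n * u\<rfloor>"
    by simp
  then show ?thesis
    using div_mult_mod_eq[of "\<lfloor>2 ^ Suc n * u\<rfloor>" 2]
    by (simp add: binary_digit_def mod_2_eq_odd del: power_Suc)
qed

text \<open>Division with remainder by \<open>3 ^ (L * n)\<close> peels the last bit off a block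
  sum, and \<open>floor_power_Suc\<close> rebuilds the floor from the bits, starting from 0 on the
  unit interval.\<close>

lemma block_sum_binary_digit_inject:
  assumes "0 < L" "u \<in> {0..<1}" "v \<in> {0..<1}"
    and "block_sum L (binary_digit u) n = block_sum L (binary_digit v) n"
  shows "\<lfloor>2 ^ n * u\<rfloor> = \<lfloor>2 ^ n * v\<rfloor>"
  using assms(4)
proof (induction n)
  case 0
  have "\<lfloor>u\<rfloor> = 0" "\<lfloor>v\<rfloor> = 0"
    using assms(2,3) by (simp_all add: floor_eq_iff)
  then show ?case
    by simp
next
  case (Suc n)
  have "block_sum L (binary_digit w) (Suc n) div 3 ^ (L * n) = of_bool (binary_digit w n)"
    "block_sum L (binary_digit w) (Suc n) mod 3 ^ (L * n) = block_sum L (binary_digit w) n" for w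
    using block_sum_less[OF assms(1), of "binary_digit w" n] block_sum_nonneg[of L "binary_digit w" n]
    by (simp_all add: block_sum_Suc)
  then show ?case
    unfolding floor_power_Suc using Suc by metis
qed

text \<open>Of \<open>L * n + N\<close> common ternary digits, cancelling the factor
  \<open>N\<close> costs at most \<open>N\<close>; the rest are \<open>n\<close> full blocks, that
  is, \<open>n\<close> common binary digits.\<close>

lemma abs_diff_le_of_dist_sparse3:
  assumes "0 < L" "0 < N" "u \<in> {0..<1}" "v \<in> {0..<1}"
    and "dist (of_nat N * sparse3 L (binary_digit u)) (of_nat N * sparse3 L (binary_digit v))
           \<le> (1/3) ^ (L * n + N)"
  shows "\<bar>u - v\<bar> \<le> (1/2) ^ n"
proof -
  have "res3 (sparse3 L (binary_digit u)) (L * n) = res3 (sparse3 L (binary_digit v)) (L * n)"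
    using assms(2,5) unfolding dist_zadic3_le_iff by (rule res3_mult_of_nat_cancel)
  then have "\<lfloor>2 ^ n * u\<rfloor> = \<lfloor>2 ^ n * v\<rfloor>"
    using assms by (intro block_sum_binary_digit_inject) (simp_all add: res3_sparse3_block)
  then have "\<bar>2 ^ n * u - 2 ^ n * v\<bar> \<le> 1"
    by linarith
  then have "2 ^ n * \<bar>u - v\<bar> \<le> 1"
    by (simp add: abs_mult flip: right_diff_distrib)
  then show ?thesis
    by (simp add: field_simps)
qed

text \<open>The exponent \<open>log 3 2 / L\<close> turns \<open>L\<close> ternary digits into one
  factor of 2. The constant pays for \<open>N\<close> digits lost by cancellation and up to
  \<open>L\<close> lost by rounding down to full blocks.\<close>

lemma abs_diff_le_dist_sparse3_powr:
  assumes "0 < L" "0 < N" "u \<in> {0..<1}" "v \<in> {0..<1}"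
  shows "\<bar>u - v\<bar> \<le> 3 powr (real (L + N) * (log 3 2 / L)) *
    dist (of_nat N * sparse3 L (binary_digit u)) (of_nat N * sparse3 L (binary_digit v))
      powr (log 3 2 / L)"
    (is "_ \<le> _ * dist ?x ?y powr ?t")
proof (cases "?x = ?y")
  \<comment> \<open>The right-hand side is 0 here, so \<open>u = v\<close> has to follow from
    agreement to every order.\<close>
  case True
  have "(\<lambda>n. (1/2 :: real) ^ n) \<longlonglongrightarrow> 0"
    by (rule LIMSEQ_power_zero) simp
  moreover have "\<bar>u - v\<bar> \<le> (1/2) ^ n" for n
    using assms True by (intro abs_diff_le_of_dist_sparse3[of L N]) auto
  ultimately have "\<bar>u - v\<bar> \<le> 0"
    by (intro LIMSEQ_le_const) auto
  then show ?thesis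
    using True by simp
next
  case False
  then obtain r where r: "dist ?x ?y = (1/3) ^ r"
    using dist_zadic3_cases by blast
  \<comment> \<open>The number of full blocks left after cancelling \<open>N\<close>. For
    \<open>r < N\<close>, truncated subtraction gives \<open>n = 0\<close>, and the bound is just
    the length of the unit interval.\<close>
  define n where "n = (r - N) div L"
  have "\<bar>u - v\<bar> \<le> (1/2) ^ n"
  proof (cases "N \<le> r")
    case True
    then have "L * n + N \<le> r"
      using times_div_less_eq_dividend[of L "r - N"] unfolding n_def by linarith
    then show ?thesis
      using assms by (intro abs_diff_le_of_dist_sparse3[of L N]) (auto simp: r intro: power_decreasing)
  next
    case False
    then show ?thesis
      using assms by (auto simp: n_def)
  qed
  also have "(1/2) ^ n = 3 powr (- (n * log 3 2))"
  proof -
    have "3 powr (n * log 3 2) = (3 powr log 3 2) powr n"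
      by (simp only: powr_powr mult.commute)
    also have "\<dots> = 2 ^ n"
      by (simp add: powr_realpow)
    finally show ?thesis
      by (simp only: powr_minus power_one_over inverse_eq_divide)
  qed
  also have "\<dots> \<le> 3 powr ((L + N) * ?t - r * ?t)"
  proof -
    have "r - N < L * Suc n"
      using assms(1) by (simp add: n_def dividend_less_times_div)
    then have "r \<le> L * n + L + N"
      by simp
    then have "real r \<le> real (L * n + L + N)"
      by (simp only: of_nat_le_iff)
    then have "r * ?t \<le> (L * n + L + N) * ?t"
      by (intro mult_right_mono) auto
    moreover have "(L * n + L + N) * ?t = (L + N) * ?t + n * log 3 2"
      using assms(1) by (simp add: field_simps)
    ultimately show ?thesis
      by simp
  qed
  also have "\<dots> = 3 powr ((L + N) * ?t) * (3 powr (- real r)) powr ?t"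
    by (simp only: powr_powr diff_conv_add_uminus powr_add mult_minus_left)
  also have "3 powr (- real r) = dist ?x ?y"
    unfolding r by (simp add: powr_minus powr_realpow inverse_eq_divide power_one_over)
  finally show ?thesis .
qed

theorem theorem1p7:
  fixes k :: nat and M :: "nat \<Rightarrow> nat" and N :: nat
  assumes "1 \<le> k"
    and "1 \<le> M 1"
    and "strict_mono_on {1..k} M"
    and "0 < N"
    and "of_nat N \<in> cantor3"
    and "\<And>i. 1 \<le> i \<Longrightarrow> i \<le> k \<Longrightarrow> of_nat (N * M i) \<in> cantor3"
  shows "hausdorff_dim (cantor3_intersection k M)
           \<ge> ennreal (log 3 2 / real_of_int \<lceil>log 3 (real (N * M k))\<rceil>)"
proof -
  have mono: "M i \<le> M k" if "i \<in> {1..k}" for i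
    using strict_mono_on_leD[OF assms(3)] that by auto
  define L where "L = nat \<lceil>log 3 (real (N * M k))\<rceil>"
  have pos: "1 \<le> N * M k"
    using mono[of 1] assms(1,2,4) by (simp add: Suc_le_eq)
  then have "0 \<le> log 3 (real (N * M k))"
    by (simp only: zero_le_log_cancel_iff real_of_nat_ge_one_iff)
  then have L: "real_of_int \<lceil>log 3 (real (N * M k))\<rceil> = real L"
    by (simp add: L_def)
  show ?thesis
  proof (cases "L = 0")
    \<comment> \<open>Now \<open>N * M k = 1\<close>, and the claimed bound is 0 because division by
      zero yields 0.\<close>
    case True
    then show ?thesis
      unfolding L by simp
  next
    case False
    have "log 3 (real (N * M k)) \<le> real L"
      unfolding L[symmetric] by (rule le_of_int_ceiling)
    then have "real (N * M k) \<le> 3 powr real L"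
      using pos by (subst (asm) log_le_iff) auto
    then have "real (N * M k) \<le> real (3 ^ L)"
      by (simp add: powr_realpow)
    then have le: "N * M k \<le> 3 ^ L"
      by (simp only: of_nat_le_iff)
    \<comment> \<open>Regrouping makes \<open>N * M i\<close> the multiplier of the sparse number;
      it omits the digit 2 and is at most \<open>3 ^ L\<close>.\<close>
    have "of_nat (M i) * (of_nat N * sparse3 L e) \<in> cantor3" if "i \<in> {1..k}" for i e
    proof -
      have "N * M i \<le> 3 ^ L"
        using mono[OF that] le by (meson mult_le_mono2 order_trans)
      then have "of_nat (N * M i) * sparse3 L e \<in> cantor3"
        using that False assms(6) by (intro mult_sparse3_in_cantor3) auto
      then show ?thesis
        by (simp add: mult_ac)
    qed
    then have "(\<lambda>u. of_nat N * sparse3 L (binary_digit u)) ` {0..<1} \<subseteq> cantor3_intersection k M"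
      by (auto simp: cantor3_intersection_def)
    then have "ennreal (log 3 2 / real L) \<le> hausdorff_dim (cantor3_intersection k M)"
      using abs_diff_le_dist_sparse3_powr[of L N] False assms(4)
      by (intro hausdorff_dim_ge_expanding) auto
    then show ?thesis
      unfolding L .
  qed
qed

end
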